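(* Let $A \in \mathbb{R}^{n\times m}$, $\eta \in \mathbb{R}$ with $\eta \neq 0$, $k\ge 1$, and $p_1,\dots,p_k,q_1,\dots,q_k\in\mathbb{R}$. Put $S(z) = z^k - p_1 z^{k-1} - \dots - p_k$ and $G(z) = q_1 z^{k-1} + \dots + q_k$, and assume $S(1) = 0$ and $G(1) \neq 0$. Let $(\mathbf{x}_t)_{t\ge0}$ in $\mathbb{R}^n$ and $(\mathbf{y}_t)_{t\ge0}$ in $\mathbb{R}^m$ satisfy the HGDA dynamics $$\mathbf{x}_{t+k} = \sum_{i=1}^k p_i \mathbf{x}_{t+k-i} - \eta \sum_{i=1}^k q_i A\mathbf{y}_{t+k-i}, \qquad \mathbf{y}_{t+k} = \sum_{i=1}^k p_i \mathbf{y}_{t+k-i} + \eta \sum_{i=1}^k q_i A^T\mathbf{x}_{t+k-i} \qquad (t\ge 0).$$ If the dynamics converge, i.e. $\mathbf{x}_t \to \mathbf{x}_\infty$ and $\mathbf{y}_t\to\mathbf{y}_\infty$ as $t\to\infty$, then $(\mathbf{x}_\infty,\mathbf{y}_\infty)$ is a Nash equilibrium of the bilinear game $f(\mathbf{x},\mathbf{y}) = \mathbf{x}^TA\mathbf{y}$.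
   Context: HGDA stands for Historical Gradient Descent/Ascent with time horizon $k$. The game is unconstrained, with strategy spaces $\mathbb{R}^n$ and $\mathbb{R}^m$. A Nash equilibrium is a pair $(\mathbf{x}^*,\mathbf{y}^* )$ with $f(\mathbf{x}^*,\mathbf{y}) \le f(\mathbf{x}^*,\mathbf{y}^* ) \le f(\mathbf{x},\mathbf{y}^* )$ for all $\mathbf{x}\in\mathbb{R}^n$, $\mathbf{y}\in\mathbb{R}^m$. *)

theory Defs
  imports "HOL-Analysis.Analysis" "HOL-Computational_Algebra.Polynomial"
begin

text \<open>Coefficient families \<open>p\<close>, \<open>q\<close> are functions on the naturals of which only the values at
  \<open>1, \<dots>, k\<close> are used.  All truncating subtractions below have the form \<open>k - i\<close> or \<open>t + k - i\<close>
  with \<open>i \<le> k\<close>, so they are genuine subtractions.\<close>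

definition S_poly :: "nat \<Rightarrow> (nat \<Rightarrow> real) \<Rightarrow> real poly" where
  "S_poly k p = monom 1 k - (\<Sum>i=1..k. monom (p i) (k - i))"

definition G_poly :: "nat \<Rightarrow> (nat \<Rightarrow> real) \<Rightarrow> real poly" where
  "G_poly k q = (\<Sum>i=1..k. monom (q i) (k - i))"

text \<open>\<open>real ^ 'm ^ 'n\<close> is the type of matrices with rows indexed by \<open>'n\<close> and columns by \<open>'m\<close>.\<close>

definition HGDA_dynamics ::
  "real ^ 'm ^ 'n \<Rightarrow> real \<Rightarrow> nat \<Rightarrow> (nat \<Rightarrow> real) \<Rightarrow> (nat \<Rightarrow> real) \<Rightarrow>
   (nat \<Rightarrow> real ^ 'n) \<Rightarrow> (nat \<Rightarrow> real ^ 'm) \<Rightarrow> bool" where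
  "HGDA_dynamics A \<eta> k p q x y \<longleftrightarrow>
     (\<forall>t.
       x (t + k) = (\<Sum>i=1..k. p i *\<^sub>R x (t + k - i))
                   - \<eta> *\<^sub>R (\<Sum>i=1..k. q i *\<^sub>R (A *v y (t + k - i))) \<and>
       y (t + k) = (\<Sum>i=1..k. p i *\<^sub>R y (t + k - i))
                   + \<eta> *\<^sub>R (\<Sum>i=1..k. q i *\<^sub>R (transpose A *v x (t + k - i))))"

definition bilinear_game :: "real ^ 'm ^ 'n \<Rightarrow> real ^ 'n \<Rightarrow> real ^ 'm \<Rightarrow> real" where
  "bilinear_game A x y = x \<bullet> (A *v y)"

text \<open>Unconstrained game: the strategy spaces are the full types \<open>'a\<close> (minimising player) and
  \<open>'b\<close> (maximising player).\<close>

definition nash_equilibrium :: "('a \<Rightarrow> 'b \<Rightarrow> real) \<Rightarrow> 'a \<Rightarrow> 'b \<Rightarrow> bool" where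
  "nash_equilibrium f x' y' \<longleftrightarrow> (\<forall>x y. f x' y \<le> f x' y' \<and> f x' y' \<le> f x y')"

end

theory Submission
  imports Defs
begin

text \<open>Let t tend to infinity in the update of x. The delayed iterates share the limits of x
  and y, so x_inf = (\<Sum> p i) x_inf - \<eta> (\<Sum> q i) A y_inf. Since S(1) = 0 means that the
  p i sum to 1, x_inf cancels; since \<eta> and G(1) = \<Sum> q i are nonzero, A y_inf = 0. The
  update of y gives A^T x_inf = 0 in the same way (\<open>forced_recurrence_limit_zero\<close>).
  Such a pair is an equilibrium because neither player can move the payoff away from 0 alone
  (\<open>nash_equilibrium_bilinear_gameI\<close>).\<close>

lemma poly_S_poly_1: "poly (S_poly k p) 1 = 1 - (\<Sum>i=1..k. p i)"
  by (simp add: S_poly_def poly_sum poly_monom)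

lemma poly_G_poly_1: "poly (G_poly k q) 1 = (\<Sum>i=1..k. q i)"
  by (simp add: G_poly_def poly_sum poly_monom)

lemma LIMSEQ_weighted_history:
  fixes u :: "nat \<Rightarrow> 'a::real_normed_vector"
  assumes "u \<longlonglongrightarrow> l"
  shows "(\<lambda>t. \<Sum>i=1..k. c i *\<^sub>R u (t + k - i)) \<longlonglongrightarrow> (\<Sum>i=1..k. c i) *\<^sub>R l"
proof -
  \<comment> \<open>As i \<le> k, the index equals t + (k - i), so this is a tail of
    \<open>u\<close>.\<close>
  have "(\<lambda>t. u (t + k - i)) \<longlonglongrightarrow> l" if "i \<in> {1..k}" for i
    using LIMSEQ_ignore_initial_segment[OF assms, of "k - i"] that by simp
  then show ?thesis
    unfolding scaleR_sum_left by (intro tendsto_sum tendsto_scaleR tendsto_const)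
qed

text \<open>Serves both players: \<open>u\<close> is one player's sequence, \<open>v\<close> the
  other's after applying the matrix or its transpose. In the limit the weights \<open>p\<close>
  reproduce \<open>l\<close> exactly, so the forcing term c (\<Sum> q i) m must vanish.\<close>

lemma forced_recurrence_limit_zero:
  fixes u v :: "nat \<Rightarrow> 'a::real_normed_vector"
  assumes rec: "\<And>t. u (t + k) = (\<Sum>i=1..k. p i *\<^sub>R u (t + k - i))
                             + c *\<^sub>R (\<Sum>i=1..k. q i *\<^sub>R v (t + k - i))"
    and "u \<longlonglongrightarrow> l" and "v \<longlonglongrightarrow> m"
    and "(\<Sum>i=1..k. p i) = 1" and "(\<Sum>i=1..k. q i) \<noteq> 0" and "c \<noteq> 0"
  shows "m = 0"
proof -
  have "(\<lambda>t. u (t + k)) \<longlonglongrightarrow> (\<Sum>i=1..k. p i) *\<^sub>R l + c *\<^sub>R (\<Sum>i=1..k. q i) *\<^sub>R m"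
    unfolding rec using assms(2,3)
    by (intro tendsto_add tendsto_scaleR tendsto_const LIMSEQ_weighted_history)
  moreover have "(\<lambda>t. u (t + k)) \<longlonglongrightarrow> l"
    using assms(2) by (rule LIMSEQ_ignore_initial_segment)
  ultimately have "(\<Sum>i=1..k. p i) *\<^sub>R l + c *\<^sub>R (\<Sum>i=1..k. q i) *\<^sub>R m = l"
    by (rule LIMSEQ_unique)
  with assms(4-6) show ?thesis by simp
qed

text \<open>By adjointness x' \<bullet> A y = A^T x' \<bullet> y = 0 for every y, while x \<bullet>
  A y' = 0 for every x. Both equilibrium inequalities thus read 0 \<le> 0.\<close>

lemma nash_equilibrium_bilinear_gameI:
  fixes A :: "real ^ 'm ^ 'n"
  assumes "A *v y' = 0" and "transpose A *v x' = 0"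
  shows "nash_equilibrium (bilinear_game A) x' y'"
proof -
  have "x' \<bullet> (A *v y) = 0" for y
    using assms(2) by (metis dot_lmul_matrix inner_zero_left transpose_matrix_vector)
  with assms(1) show ?thesis
    by (simp add: nash_equilibrium_def bilinear_game_def)
qed

theorem proposition4p1:
  fixes A :: "real ^ 'm ^ 'n" and \<eta> :: real and k :: nat
    and p q :: "nat \<Rightarrow> real"
    and x :: "nat \<Rightarrow> real ^ 'n" and y :: "nat \<Rightarrow> real ^ 'm"
    and x_inf :: "real ^ 'n" and y_inf :: "real ^ 'm"
  assumes "\<eta> \<noteq> 0" and "k \<ge> 1"
    and "poly (S_poly k p) 1 = 0"
    and "poly (G_poly k q) 1 \<noteq> 0"
    and "HGDA_dynamics A \<eta> k p q x y"
    and "x \<longlonglongrightarrow> x_inf" and "y \<longlonglongrightarrow> y_inf"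
  shows "nash_equilibrium (bilinear_game A) x_inf y_inf"
proof (rule nash_equilibrium_bilinear_gameI)
  have p: "(\<Sum>i=1..k. p i) = 1" and q: "(\<Sum>i=1..k. q i) \<noteq> 0"
    using assms(3,4) by (simp_all add: poly_S_poly_1 poly_G_poly_1)
  show "A *v y_inf = 0"
  proof (rule forced_recurrence_limit_zero[OF _ assms(6) _ p q])
    \<comment> \<open>The descent sign goes into the constant, c = -\<eta>, so that one lemma covers
      descent and ascent.\<close>
    show "x (t + k) = (\<Sum>i=1..k. p i *\<^sub>R x (t + k - i))
                      + (- \<eta>) *\<^sub>R (\<Sum>i=1..k. q i *\<^sub>R (A *v y (t + k - i)))" for t
      using assms(5) unfolding HGDA_dynamics_def by simp
    show "(\<lambda>t. A *v y t) \<longlonglongrightarrow> A *v y_inf"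
      using assms(7) by (rule bounded_linear.tendsto[OF matrix_vector_mul_bounded_linear])
  qed (use assms(1) in simp)
  show "transpose A *v x_inf = 0"
  proof (rule forced_recurrence_limit_zero[OF _ assms(7) _ p q assms(1)])
    show "y (t + k) = (\<Sum>i=1..k. p i *\<^sub>R y (t + k - i))
                      + \<eta> *\<^sub>R (\<Sum>i=1..k. q i *\<^sub>R (transpose A *v x (t + k - i)))" for t
      using assms(5) unfolding HGDA_dynamics_def by blast
    show "(\<lambda>t. transpose A *v x t) \<longlonglongrightarrow> transpose A *v x_inf"
      using assms(6) by (rule bounded_linear.tendsto[OF matrix_vector_mul_bounded_linear])
  qed
qed

end
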